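(* Let $f$ be a center function with associated center $X$, and let $\ell$ be an admissible transversal of $\triangle ABC$ meeting the sidelines $BC,CA,AB$ at $D,E,F$. Let $G,H,I$ be the $X$-points of the triangles $AEF$, $BFD$, $CDE$ respectively. Set \begin{align*} s_A&=f(|FA|,|AE|,|EF|), & t_A&=f(|AE|,|EF|,|FA|),\\ s_B&=f(|DB|,|BF|,|FD|), & t_B&=f(|BF|,|FD|,|DB|),\\ s_C&=f(|EC|,|CD|,|DE|), & t_C&=f(|CD|,|DE|,|EC|), \end{align*} and write $S=s_As_Bs_C$, $T=t_At_Bt_C$. Then the lines $AG,BH,CI$ are concurrent if and only if $S+T=0$.
   Context: An admissible transversal of $\triangle ABC$ is a line that passes through no vertex and is parallel to no side. A (barycentric) center function is a real function $f(x,y,z)$ of side lengths that is homogeneous and symmetric in its last two arguments; for a triangle $P_1P_2P_3$ whose sides opposite $P_1,P_2,P_3$ have lengths $\lambda_1,\lambda_2,\lambda_3$, its $X$-point is the point with homogeneous barycentric coordinates $(f(\lambda_1,\lambda_2,\lambda_3):f(\lambda_2,\lambda_3,\lambda_1):f(\lambda_3,\lambda_1,\lambda_2))$ relative to $P_1P_2P_3$. Concurrence is meant projectively: three mutually parallel lines count as concurrent (at a point at infinity). It is tacitly understood that $f$ is defined at the side lengths involved and that $G\ne A$, $H\ne B$, $I\ne C$, so that the lines $AG,BH,CI$ make sense. *)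

theory Defs
  imports "HOL-Analysis.Analysis"
begin

definition triangle_sides :: "real \<Rightarrow> real \<Rightarrow> real \<Rightarrow> bool" where
  "triangle_sides x y z \<longleftrightarrow> x < y + z \<and> y < z + x \<and> z < x + y"

text \<open>A center function may be partial: \<open>U\<close> is the set of side length triples at which
  \<open>f\<close> is defined.  The degree of homogeneity may be any real number.\<close>

definition center_function ::
    "(real \<times> real \<times> real) set \<Rightarrow> (real \<Rightarrow> real \<Rightarrow> real \<Rightarrow> real) \<Rightarrow> bool" where
  "center_function U f \<longleftrightarrow>
     (\<forall>x y z. (x, y, z) \<in> U \<longrightarrow> triangle_sides x y z) \<and>
     (\<exists>k. \<forall>x y z t. (x, y, z) \<in> U \<and> t > 0 \<longrightarrow>
        (t * x, t * y, t * z) \<in> U \<and> f (t * x) (t * y) (t * z) = t powr k * f x y z) \<and>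
     (\<forall>x y z. (x, y, z) \<in> U \<longrightarrow> (x, z, y) \<in> U \<and> f x z y = f x y z)"

text \<open>The projective closure of the Euclidean plane: projective points are the lines through the
  origin of \<open>(real^2) \<times> real\<close>, projective lines are its two-dimensional subspaces.  The point \<open>P\<close>
  of the plane is the span of \<open>(P, 1)\<close>; the points at infinity are the spans of \<open>(d, 0)\<close>
  with \<open>d \<noteq> 0\<close>.\<close>

type_synonym hvec = "(real^2) \<times> real"

definition proj_point :: "hvec set \<Rightarrow> bool" where
  "proj_point Q \<longleftrightarrow> (\<exists>v. v \<noteq> 0 \<and> Q = span {v})"

definition proj :: "real^2 \<Rightarrow> hvec set" where
  "proj P = span {(P, 1)}"

text \<open>A projective line if \<open>P\<close> and \<open>Q\<close> are distinct projective points.\<close>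

definition proj_line ::
    "hvec set \<Rightarrow> hvec set \<Rightarrow> hvec set" where
  "proj_line P Q = span (P \<union> Q)"

definition concurrent ::
    "hvec set \<Rightarrow> hvec set \<Rightarrow> hvec set \<Rightarrow> bool" where
  "concurrent L M N \<longleftrightarrow> (\<exists>Q. proj_point Q \<and> Q \<subseteq> L \<and> Q \<subseteq> M \<and> Q \<subseteq> N)"

text \<open>The point with homogeneous barycentric coordinates \<open>(u : v : w)\<close> relative to a
  triangle, for \<open>(u, v, w) \<noteq> (0, 0, 0)\<close>; it is at infinity when \<open>u + v + w = 0\<close>.\<close>

definition bary_point ::
    "real^2 \<Rightarrow> real^2 \<Rightarrow> real^2 \<Rightarrow> real \<Rightarrow> real \<Rightarrow> real \<Rightarrow> hvec set" where
  "bary_point P1 P2 P3 u v w =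
     span {u *\<^sub>R (P1, 1) + v *\<^sub>R (P2, 1) + w *\<^sub>R (P3, 1)}"

text \<open>\<open>G\<close> is the \<open>X\<close>-point of \<open>P1 P2 P3\<close>.  This includes that it exists: \<open>f\<close> is defined at the
  three side length triples and the resulting coordinates do not all vanish.\<close>

definition is_X_point ::
    "(real \<times> real \<times> real) set \<Rightarrow> (real \<Rightarrow> real \<Rightarrow> real \<Rightarrow> real) \<Rightarrow>
     real^2 \<Rightarrow> real^2 \<Rightarrow> real^2 \<Rightarrow> hvec set \<Rightarrow> bool" where
  "is_X_point U f P1 P2 P3 G \<longleftrightarrow>
     (let l1 = dist P2 P3; l2 = dist P3 P1; l3 = dist P1 P2;
          u = f l1 l2 l3; v = f l2 l3 l1; w = f l3 l1 l2
      in (l1, l2, l3) \<in> U \<and> (l2, l3, l1) \<in> U \<and> (l3, l1, l2) \<in> U \<and>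
         (u, v, w) \<noteq> (0, 0, 0) \<and> G = bary_point P1 P2 P3 u v w)"

definition admissible_transversal ::
    "real^2 \<Rightarrow> real^2 \<Rightarrow> real^2 \<Rightarrow> (real^2) set \<Rightarrow> bool" where
  "admissible_transversal A B C l \<longleftrightarrow>
     affine l \<and> aff_dim l = 1 \<and>
     A \<notin> l \<and> B \<notin> l \<and> C \<notin> l \<and>
     \<not> affine_parallel l (affine hull {B, C}) \<and>
     \<not> affine_parallel l (affine hull {C, A}) \<and>
     \<not> affine_parallel l (affine hull {A, B})"

end

theory Submission
  imports Defs
begin

text \<open>Work with homogeneous vectors: let \<open>a, b, c\<close> be the lifts \<open>(A, 1), (B, 1), (C, 1)\<close>, which are
  linearly independent because the triangle is not degenerate.  Write \<open>D = (1 - d) B + d C\<close>,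
  \<open>E = (1 - e) C + e A\<close> and \<open>F = (1 - r) A + r B\<close>; none of \<open>d, e, r\<close> is \<open>0\<close> or \<open>1\<close> because the
  transversal avoids the vertices, and collinearity of \<open>D, E, F\<close> gives Menelaus' relation (lemma \<open>menelaus\<close>)
  \<open>(1 - d) (1 - e) (1 - r) = - d e r\<close>.

  The point \<open>G\<close> is spanned by a multiple of \<open>a\<close> plus \<open>sA E + tA F\<close>, so modulo \<open>a\<close> it is
  \<open>tA r b + sA (1 - e) c\<close>; likewise \<open>H\<close> is \<open>sB (1 - r) a + tB d c\<close> modulo \<open>b\<close>, and \<open>I\<close> is
  \<open>tC e a + sC (1 - d) b\<close> modulo \<open>c\<close>.  By Ceva's theorem in homogeneous form (lemma \<open>ceva\<close>),
  the three cevians concur, possibly at infinity, iff \<open>S (1 - d) (1 - e) (1 - r) = T d e r\<close>, which by Menelaus' relation says \<open>- S = T\<close>.\<close>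

section \<open>Linear dependence and collinearity\<close>

text \<open>Linear independence of the family \<open>a, b, c\<close> rather than of the set \<open>{a, b, c}\<close>: repeated
  vectors count as dependent.\<close>

definition lin_indep3 :: "'a::real_vector \<Rightarrow> 'a \<Rightarrow> 'a \<Rightarrow> bool" where
  "lin_indep3 a b c \<longleftrightarrow>
     (\<forall>x y z. x *\<^sub>R a + y *\<^sub>R b + z *\<^sub>R c = 0 \<longrightarrow> x = 0 \<and> y = 0 \<and> z = 0)"

lemma lin_indep3D:
  assumes "lin_indep3 a b c" "x *\<^sub>R a + y *\<^sub>R b + z *\<^sub>R c = 0"
  shows "x = 0" "y = 0" "z = 0"
  using assms unfolding lin_indep3_def by blast+

lemma lin_indep3_eqD:
  assumes "lin_indep3 a b c"
    and "x *\<^sub>R a + y *\<^sub>R b + z *\<^sub>R c = x' *\<^sub>R a + y' *\<^sub>R b + z' *\<^sub>R c"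
  shows "x = x'" "y = y'" "z = z'"
proof -
  have "(x - x') *\<^sub>R a + (y - y') *\<^sub>R b + (z - z') *\<^sub>R c = 0"
    using assms(2) by (simp add: algebra_simps)
  from lin_indep3D[OF assms(1) this] show "x = x'" "y = y'" "z = z'" by auto
qed

lemma lin_indep3_rotate:
  assumes "lin_indep3 a b c"
  shows "lin_indep3 b c a"
  unfolding lin_indep3_def
proof (intro allI impI)
  fix x y z assume "x *\<^sub>R b + y *\<^sub>R c + z *\<^sub>R a = 0"
  then have "z *\<^sub>R a + x *\<^sub>R b + y *\<^sub>R c = 0" by (simp add: algebra_simps)
  from lin_indep3D[OF assms this] show "x = 0 \<and> y = 0 \<and> z = 0" by simp
qed

lemma collinear_iff_lifts_dependent:
  fixes P Q R :: "'a::real_vector"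
  shows "collinear {P, Q, R} \<longleftrightarrow> \<not> lin_indep3 (P, 1::real) (Q, 1) (R, 1)"
proof
  assume "collinear {P, Q, R}"
  then obtain u where u: "\<forall>x\<in>{P, Q, R}. \<forall>y\<in>{P, Q, R}. \<exists>k. x - y = k *\<^sub>R u"
    unfolding collinear_def by blast
  then obtain h k where h: "P - R = h *\<^sub>R u" and k: "Q - R = k *\<^sub>R u" by blast
  show "\<not> lin_indep3 (P, 1::real) (Q, 1) (R, 1)"
  proof
    assume ind: "lin_indep3 (P, 1::real) (Q, 1) (R, 1)"
    have PQR: "P = R + h *\<^sub>R u" "Q = R + k *\<^sub>R u" using h k by (simp_all add: algebra_simps)
    have "k *\<^sub>R (P, 1::real) + (- h) *\<^sub>R (Q, 1) + (h - k) *\<^sub>R (R, 1) = 0"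
      by (simp add: PQR zero_prod_def algebra_simps)
    from lin_indep3D[OF ind this] have "h = 0" "k = 0" by auto
    then have "1 *\<^sub>R (P, 1::real) + (- 1) *\<^sub>R (Q, 1) + 0 *\<^sub>R (R, 1) = 0"
      by (simp add: PQR zero_prod_def)
    from lin_indep3D(1)[OF ind this] show False by simp
  qed
next
  assume "\<not> lin_indep3 (P, 1::real) (Q, 1) (R, 1)"
  then obtain x y z where nz: "\<not> (x = 0 \<and> y = 0 \<and> z = 0)"
    and dep: "x *\<^sub>R (P, 1::real) + y *\<^sub>R (Q, 1) + z *\<^sub>R (R, 1) = 0"
    unfolding lin_indep3_def by blast
  have sum0: "z = - x - y" and vec: "x *\<^sub>R P + y *\<^sub>R Q + z *\<^sub>R R = 0"
    using dep by (auto simp: zero_prod_def)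
  have rel: "x *\<^sub>R (P - R) + y *\<^sub>R (Q - R) = 0"
    using vec by (simp add: sum0 algebra_simps)
  have line: "collinear {P, Q, R}" if "P = R + h *\<^sub>R u" "Q = R + k *\<^sub>R u" for h k u
  proof -
    note that
    moreover have "R = R + 0 *\<^sub>R u" by simp
    ultimately have form: "\<exists>k. X = R + k *\<^sub>R u" if "X \<in> {P, Q, R}" for X
      using that by blast
    show ?thesis unfolding collinear_def
    proof (intro exI[of _ u] ballI)
      fix X Y assume "X \<in> {P, Q, R}" "Y \<in> {P, Q, R}"
      then obtain i j where "X = R + i *\<^sub>R u" "Y = R + j *\<^sub>R u" using form by meson
      then have "X - Y = (i - j) *\<^sub>R u" by (simp add: algebra_simps)
      then show "\<exists>k. X - Y = k *\<^sub>R u" ..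
    qed
  qed
  show "collinear {P, Q, R}"
  proof (cases "x = 0")
    case True
    with nz sum0 have "y \<noteq> 0" by auto
    with rel True have "Q = R" by simp
    then show ?thesis by (simp add: insert_commute)
  next
    case False
    have "x *\<^sub>R (P - R) = (- y) *\<^sub>R (Q - R)"
      using rel by (simp add: eq_neg_iff_add_eq_0)
    then have "(1 / x) *\<^sub>R (x *\<^sub>R (P - R)) = (1 / x) *\<^sub>R ((- y) *\<^sub>R (Q - R))" by simp
    then have "P - R = (- y / x) *\<^sub>R (Q - R)" using False by simp
    then have "P = R + (- y / x) *\<^sub>R (Q - R)" by (simp add: diff_eq_eq add.commute)
    moreover have "Q = R + 1 *\<^sub>R (Q - R)" by simp
    ultimately show ?thesis by (rule line)
  qed
qed

lemma affine_hull_2_obtain: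
  assumes "X \<in> affine hull {P, Q}"
  obtains t where "X = (1 - t) *\<^sub>R P + t *\<^sub>R Q"
  using assms by (auto simp: affine_hull_2) (metis add_diff_cancel_right')

lemma aff_dim_1_collinear:
  assumes "aff_dim l = 1" "S \<subseteq> l"
  shows "collinear S"
  using assms aff_dim_subset[OF assms(2)] by (simp add: collinear_aff_dim)

section \<open>The theorems of Menelaus and Ceva\<close>

text \<open>Signed ratios are replaced by affine parameters, so that no division is needed.\<close>

lemma menelaus:
  fixes A B C D E F :: "'a::real_vector"
  assumes ind: "lin_indep3 (A, 1::real) (B, 1) (C, 1)"
    and col: "collinear {D, E, F}"
    and D: "D = (1 - d) *\<^sub>R B + d *\<^sub>R C"
    and E: "E = (1 - e) *\<^sub>R C + e *\<^sub>R A"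
    and F: "F = (1 - r) *\<^sub>R A + r *\<^sub>R B"
    and nz: "d \<noteq> 0" "e \<noteq> 0" "r \<noteq> 0" "d \<noteq> 1" "e \<noteq> 1" "r \<noteq> 1"
  shows "(1 - d) * (1 - e) * (1 - r) = - (d * e * r)"
proof -
  obtain x y z where xyz: "\<not> (x = 0 \<and> y = 0 \<and> z = 0)"
    and dep: "x *\<^sub>R (D, 1::real) + y *\<^sub>R (E, 1) + z *\<^sub>R (F, 1) = 0"
    using col unfolding collinear_iff_lifts_dependent lin_indep3_def by blast
  have "(y * e + z * (1 - r)) *\<^sub>R (A, 1::real) + (x * (1 - d) + z * r) *\<^sub>R (B, 1)
      + (x * d + y * (1 - e)) *\<^sub>R (C, 1) = x *\<^sub>R (D, 1) + y *\<^sub>R (E, 1) + z *\<^sub>R (F, 1)"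
    unfolding D E F by (simp add: algebra_simps)
  from lin_indep3D[OF ind this[unfolded dep]]
  have 1: "y * e = - (z * (1 - r))" and 2: "z * r = - (x * (1 - d))"
    and 3: "x * d = - (y * (1 - e))" by linarith+
  \<comment> \<open>Multiply the three equations; the common factor \<open>x * y * z\<close> cancels because the vanishing of
    one of \<open>x, y, z\<close> would force that of the others.\<close>
  have "x * y * z \<noteq> 0" using 1 2 3 nz xyz by auto
  moreover have "(x * y * z) * (d * e * r) = (x * d) * (y * e) * (z * r)" by simp
  moreover have "\<dots> = - (x * y * z) * ((1 - d) * (1 - e) * (1 - r))"
    unfolding 1 2 3 by simp
  ultimately have "(x * y * z) * (d * e * r + (1 - d) * (1 - e) * (1 - r)) = 0"
    by (simp only: distrib_left) simp
  with \<open>x * y * z \<noteq> 0\<close> show ?thesis by simp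
qed

text \<open>The equation of the cevian through \<open>a\<close> in the coordinates given by \<open>a, b, c\<close>.\<close>

lemma mem_cevian_iff:
  assumes ind: "lin_indep3 a b c"
    and nz: "\<beta> \<noteq> 0 \<or> \<gamma> \<noteq> 0"
  shows "x *\<^sub>R a + y *\<^sub>R b + z *\<^sub>R c \<in> span {a, u *\<^sub>R a + \<beta> *\<^sub>R b + \<gamma> *\<^sub>R c} \<longleftrightarrow> \<gamma> * y = \<beta> * z"
    (is "?v \<in> span {a, ?g} \<longleftrightarrow> _")
proof
  assume "?v \<in> span {a, ?g}"
  then obtain p q where "?v = p *\<^sub>R a + q *\<^sub>R ?g"
    by (auto simp: span_insert span_singleton algebra_simps)
  then have "x *\<^sub>R a + y *\<^sub>R b + z *\<^sub>R c = (p + q * u) *\<^sub>R a + (q * \<beta>) *\<^sub>R b + (q * \<gamma>) *\<^sub>R c"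
    by (simp add: algebra_simps)
  from lin_indep3_eqD[OF ind this] show "\<gamma> * y = \<beta> * z" by simp
next
  assume eq: "\<gamma> * y = \<beta> * z"
  obtain q where q: "y = q * \<beta>" "z = q * \<gamma>"
  proof (cases "\<beta> = 0")
    case True
    with nz eq show ?thesis by (intro that[of "z / \<gamma>"]) (auto simp: field_simps)
  next
    case False
    with eq show ?thesis by (intro that[of "y / \<beta>"]) (auto simp: field_simps)
  qed
  have "?v = (x - q * u) *\<^sub>R a + q *\<^sub>R ?g" unfolding q by (simp add: algebra_simps)
  also have "\<dots> \<in> span {a, ?g}"
    by (intro span_add span_scale span_base) auto
  finally show "?v \<in> span {a, ?g}" .
qed

lemma span_cevian_coordinates:
  assumes "v \<in> span {a, u *\<^sub>R a + \<beta> *\<^sub>R b + \<gamma> *\<^sub>R c}"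
  obtains x y z where "v = x *\<^sub>R a + y *\<^sub>R b + z *\<^sub>R c"
proof -
  let ?g = "u *\<^sub>R a + \<beta> *\<^sub>R b + \<gamma> *\<^sub>R c"
  obtain p q where "v = p *\<^sub>R a + q *\<^sub>R ?g"
    using assms
    by (auto simp: span_insert span_singleton algebra_simps)
  then have "v = (p + q * u) *\<^sub>R a + (q * \<beta>) *\<^sub>R b + (q * \<gamma>) *\<^sub>R c"
    by (simp add: algebra_simps)
  then show thesis by (rule that)
qed

text \<open>The right-hand side is the vanishing of the determinant of the three cevian equations.\<close>

lemma cevian_system_nontrivial_iff:
  fixes \<alpha>2 \<alpha>3 \<beta>1 \<beta>3 \<gamma>1 \<gamma>2 :: "'a::field"
  assumes nz: "\<beta>1 \<noteq> 0 \<or> \<gamma>1 \<noteq> 0" "\<gamma>2 \<noteq> 0 \<or> \<alpha>2 \<noteq> 0" "\<alpha>3 \<noteq> 0 \<or> \<beta>3 \<noteq> 0"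
  shows "(\<exists>x y z. (x \<noteq> 0 \<or> y \<noteq> 0 \<or> z \<noteq> 0) \<and> \<gamma>1 * y = \<beta>1 * z \<and> \<alpha>2 * z = \<gamma>2 * x \<and> \<beta>3 * x = \<alpha>3 * y)
    \<longleftrightarrow> \<alpha>2 * \<beta>3 * \<gamma>1 = \<alpha>3 * \<beta>1 * \<gamma>2" (is "?L \<longleftrightarrow> ?R")
proof
  assume ?L
  then obtain x y z where xyz: "x \<noteq> 0 \<or> y \<noteq> 0 \<or> z \<noteq> 0"
    and eqs: "\<gamma>1 * y = \<beta>1 * z" "\<alpha>2 * z = \<gamma>2 * x" "\<beta>3 * x = \<alpha>3 * y" by blast
  have "x * (\<alpha>2 * \<beta>3 * \<gamma>1 - \<alpha>3 * \<beta>1 * \<gamma>2) = 0" "y * (\<alpha>2 * \<beta>3 * \<gamma>1 - \<alpha>3 * \<beta>1 * \<gamma>2) = 0"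
    "z * (\<alpha>2 * \<beta>3 * \<gamma>1 - \<alpha>3 * \<beta>1 * \<gamma>2) = 0"
    using eqs by algebra+
  with xyz show ?R by auto
next
  assume R: ?R
  show ?L
  proof (cases "\<gamma>1 = 0 \<and> \<gamma>2 = 0")
    \<comment> \<open>The first two cevians are both the line \<open>z = 0\<close>.\<close>
    case True
    with nz(3) show ?thesis
      by (intro exI[of _ \<alpha>3] exI[of _ \<beta>3] exI[of _ 0]) auto
  next
    \<comment> \<open>The cross product of the coefficient vectors of the first two equations.\<close>
    case False
    with nz R show ?thesis
      by (intro exI[of _ "\<alpha>2 * \<gamma>1"] exI[of _ "\<beta>1 * \<gamma>2"] exI[of _ "\<gamma>1 * \<gamma>2"])
        (auto simp: algebra_simps)
  qed
qed

lemma concurrent_iff_common_vector: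
  assumes "subspace L" "subspace M" "subspace N"
  shows "concurrent L M N \<longleftrightarrow> (\<exists>v. v \<noteq> 0 \<and> v \<in> L \<and> v \<in> M \<and> v \<in> N)"
proof
  assume "concurrent L M N"
  then obtain v where "v \<noteq> 0" "span {v} \<subseteq> L" "span {v} \<subseteq> M" "span {v} \<subseteq> N"
    unfolding concurrent_def proj_point_def by auto
  moreover have "v \<in> span {v}" by (simp add: span_base)
  ultimately show "\<exists>v. v \<noteq> 0 \<and> v \<in> L \<and> v \<in> M \<and> v \<in> N" by blast
next
  assume "\<exists>v. v \<noteq> 0 \<and> v \<in> L \<and> v \<in> M \<and> v \<in> N"
  then obtain v where v: "v \<noteq> 0" "v \<in> L" "v \<in> M" "v \<in> N" by blast
  then have "span {v} \<subseteq> L" "span {v} \<subseteq> M" "span {v} \<subseteq> N"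
    using assms by (simp_all add: span_minimal)
  with v(1) show "concurrent L M N"
    unfolding concurrent_def proj_point_def by blast
qed

lemma proj_line_span: "proj_line (span {v}) (span {w}) = span {v, w}"
proof -
  have "span (span {v} \<union> span {w}) = span ({v} \<union> {w})"
    unfolding span_Un by (simp only: span_span)
  then show ?thesis by (simp add: proj_line_def insert_commute)
qed

text \<open>Ceva's theorem in homogeneous coordinates; the coefficients \<open>u1\<close>, \<open>u2\<close>, \<open>u3\<close> of the vertices
  themselves do not matter.\<close>

lemma ceva:
  assumes ind: "lin_indep3 a b c"
    and nz: "\<beta>1 \<noteq> 0 \<or> \<gamma>1 \<noteq> 0" "\<gamma>2 \<noteq> 0 \<or> \<alpha>2 \<noteq> 0" "\<alpha>3 \<noteq> 0 \<or> \<beta>3 \<noteq> 0"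
  shows "concurrent (span {a, u1 *\<^sub>R a + \<beta>1 *\<^sub>R b + \<gamma>1 *\<^sub>R c})
      (span {b, u2 *\<^sub>R b + \<gamma>2 *\<^sub>R c + \<alpha>2 *\<^sub>R a})
      (span {c, u3 *\<^sub>R c + \<alpha>3 *\<^sub>R a + \<beta>3 *\<^sub>R b})
    \<longleftrightarrow> \<alpha>2 * \<beta>3 * \<gamma>1 = \<alpha>3 * \<beta>1 * \<gamma>2"
    (is "concurrent ?L ?M ?N \<longleftrightarrow> _")
proof -
  note ind2 = lin_indep3_rotate[OF ind]
  note ind3 = lin_indep3_rotate[OF ind2]
  have rot: "x *\<^sub>R a + y *\<^sub>R b + z *\<^sub>R c = y *\<^sub>R b + z *\<^sub>R c + x *\<^sub>R a"
    "x *\<^sub>R a + y *\<^sub>R b + z *\<^sub>R c = z *\<^sub>R c + x *\<^sub>R a + y *\<^sub>R b" for x y z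
    by (simp_all add: algebra_simps)
  have mem: "x *\<^sub>R a + y *\<^sub>R b + z *\<^sub>R c \<in> ?L \<longleftrightarrow> \<gamma>1 * y = \<beta>1 * z"
    "x *\<^sub>R a + y *\<^sub>R b + z *\<^sub>R c \<in> ?M \<longleftrightarrow> \<alpha>2 * z = \<gamma>2 * x"
    "x *\<^sub>R a + y *\<^sub>R b + z *\<^sub>R c \<in> ?N \<longleftrightarrow> \<beta>3 * x = \<alpha>3 * y" for x y z
    subgoal by (rule mem_cevian_iff[OF ind nz(1)])
    subgoal unfolding rot(1) by (rule mem_cevian_iff[OF ind2 nz(2)])
    subgoal unfolding rot(2) by (rule mem_cevian_iff[OF ind3 nz(3)])
    done
  have nonzero: "x *\<^sub>R a + y *\<^sub>R b + z *\<^sub>R c \<noteq> 0 \<longleftrightarrow> x \<noteq> 0 \<or> y \<noteq> 0 \<or> z \<noteq> 0" for x y z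
    using lin_indep3D[OF ind, of x y z] by auto
  have "concurrent ?L ?M ?N \<longleftrightarrow> (\<exists>v. v \<noteq> 0 \<and> v \<in> ?L \<and> v \<in> ?M \<and> v \<in> ?N)"
    by (intro concurrent_iff_common_vector subspace_span)
  also have "\<dots> \<longleftrightarrow> (\<exists>x y z. (x \<noteq> 0 \<or> y \<noteq> 0 \<or> z \<noteq> 0) \<and>
      \<gamma>1 * y = \<beta>1 * z \<and> \<alpha>2 * z = \<gamma>2 * x \<and> \<beta>3 * x = \<alpha>3 * y)"
  proof
    assume "\<exists>v. v \<noteq> 0 \<and> v \<in> ?L \<and> v \<in> ?M \<and> v \<in> ?N"
    then obtain v where v: "v \<noteq> 0" "v \<in> ?L" "v \<in> ?M" "v \<in> ?N" by blast
    obtain x y z where "v = x *\<^sub>R a + y *\<^sub>R b + z *\<^sub>R c"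
      by (rule span_cevian_coordinates[OF v(2)])
    with v show "\<exists>x y z. (x \<noteq> 0 \<or> y \<noteq> 0 \<or> z \<noteq> 0) \<and>
        \<gamma>1 * y = \<beta>1 * z \<and> \<alpha>2 * z = \<gamma>2 * x \<and> \<beta>3 * x = \<alpha>3 * y"
      using mem nonzero by metis
  next
    assume "\<exists>x y z. (x \<noteq> 0 \<or> y \<noteq> 0 \<or> z \<noteq> 0) \<and>
        \<gamma>1 * y = \<beta>1 * z \<and> \<alpha>2 * z = \<gamma>2 * x \<and> \<beta>3 * x = \<alpha>3 * y"
    then obtain x y z where "x \<noteq> 0 \<or> y \<noteq> 0 \<or> z \<noteq> 0"
      "\<gamma>1 * y = \<beta>1 * z" "\<alpha>2 * z = \<gamma>2 * x" "\<beta>3 * x = \<alpha>3 * y" by blast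
    then show "\<exists>v. v \<noteq> 0 \<and> v \<in> ?L \<and> v \<in> ?M \<and> v \<in> ?N"
      by (intro exI[of _ "x *\<^sub>R a + y *\<^sub>R b + z *\<^sub>R c"]) (simp only: mem nonzero simp_thms)
  qed
  also have "\<dots> \<longleftrightarrow> \<alpha>2 * \<beta>3 * \<gamma>1 = \<alpha>3 * \<beta>1 * \<gamma>2"
    by (rule cevian_system_nontrivial_iff[OF nz])
  finally show ?thesis .
qed

section \<open>Lines from a vertex to the center of a corner triangle\<close>

text \<open>Only the coordinates at the two vertices other than \<open>P1\<close> influence the line from \<open>P1\<close> to the
  \<open>X\<close>-point, and they cannot both vanish, as the \<open>X\<close>-point would then be \<open>P1\<close> itself.\<close>

lemma X_point_nondegenerate:
  assumes X: "is_X_point U f P1 P2 P3 G" and G: "G \<noteq> proj P1"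
  obtains u where
    "G = bary_point P1 P2 P3 u
       (f (dist P3 P1) (dist P1 P2) (dist P2 P3)) (f (dist P1 P2) (dist P2 P3) (dist P3 P1))"
    "f (dist P3 P1) (dist P1 P2) (dist P2 P3) \<noteq> 0 \<or> f (dist P1 P2) (dist P2 P3) (dist P3 P1) \<noteq> 0"
proof -
  define u where "u = f (dist P2 P3) (dist P3 P1) (dist P1 P2)"
  define v where "v = f (dist P3 P1) (dist P1 P2) (dist P2 P3)"
  define w where "w = f (dist P1 P2) (dist P2 P3) (dist P3 P1)"
  have nz: "(u, v, w) \<noteq> (0, 0, 0)" and Geq: "G = bary_point P1 P2 P3 u v w"
    using X unfolding is_X_point_def Let_def u_def v_def w_def by auto
  have "v \<noteq> 0 \<or> w \<noteq> 0"
  proof (rule ccontr)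
    assume "\<not> (v \<noteq> 0 \<or> w \<noteq> 0)"
    with nz have vw: "v = 0" "w = 0" "u \<noteq> 0" by auto
    have "G = span {u *\<^sub>R (P1, 1)}"
      unfolding Geq bary_point_def vw(1,2) by simp
    also have "\<dots> = span {(P1, 1)}"
    proof
      have "u *\<^sub>R (P1, 1::real) \<in> span {(P1, 1)}" by (intro span_scale span_base) simp
      then show "span {u *\<^sub>R (P1, 1::real)} \<subseteq> span {(P1, 1)}"
        by (intro span_minimal) auto
      have "(1 / u) *\<^sub>R u *\<^sub>R (P1, 1::real) \<in> span {u *\<^sub>R (P1, 1)}"
        by (intro span_scale span_base) simp
      then show "span {(P1, 1::real)} \<subseteq> span {u *\<^sub>R (P1, 1)}"
        using vw(3) by (intro span_minimal) auto
    qed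
    finally show False using G by (simp add: proj_def)
  qed
  with Geq show thesis unfolding v_def w_def by (rule that)
qed

text \<open>If \<open>E\<close> lies on \<open>CA\<close> and \<open>F\<close> on \<open>AB\<close>, the span of \<open>A\<close> and the point \<open>(u : s : t)\<close>
  relative to \<open>AEF\<close>, written in barycentric coordinates relative to \<open>ABC\<close>.\<close>

lemma corner_line_eq_cevian:
  fixes A B C E F :: "real^2"
  assumes E: "E = (1 - e) *\<^sub>R C + e *\<^sub>R A" and F: "F = (1 - r) *\<^sub>R A + r *\<^sub>R B"
  shows "proj_line (proj A) (bary_point A E F u s t) =
    span {(A, 1), (u + s * e + t * (1 - r)) *\<^sub>R (A, 1) + (t * r) *\<^sub>R (B, 1) + (s * (1 - e)) *\<^sub>R (C, 1)}"
proof -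
  have "u *\<^sub>R (A, 1::real) + s *\<^sub>R (E, 1) + t *\<^sub>R (F, 1)
    = (u + s * e + t * (1 - r)) *\<^sub>R (A, 1) + (t * r) *\<^sub>R (B, 1) + (s * (1 - e)) *\<^sub>R (C, 1)"
    unfolding E F by (simp add: algebra_simps)
  then show ?thesis unfolding proj_def bary_point_def proj_line_span by (simp only:)
qed

section \<open>Concurrence for corner triangles of a transversal\<close>

theorem theorem3p1:
  fixes U :: "(real \<times> real \<times> real) set"
    and f :: "real \<Rightarrow> real \<Rightarrow> real \<Rightarrow> real"
    and A B C D E F :: "real^2"
    and l :: "(real^2) set"
    and G H I :: "hvec set"
    and sA tA sB tB sC tC S T :: real
  assumes "center_function U f"
    and "\<not> collinear {A, B, C}"
    and "admissible_transversal A B C l"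
    and "l \<inter> affine hull {B, C} = {D}"
    and "l \<inter> affine hull {C, A} = {E}"
    and "l \<inter> affine hull {A, B} = {F}"
    and "is_X_point U f A E F G"
    and "is_X_point U f B F D H"
    and "is_X_point U f C D E I"
    and "G \<noteq> proj A" and "H \<noteq> proj B" and "I \<noteq> proj C"
    and "sA = f (dist F A) (dist A E) (dist E F)"
    and "tA = f (dist A E) (dist E F) (dist F A)"
    and "sB = f (dist D B) (dist B F) (dist F D)"
    and "tB = f (dist B F) (dist F D) (dist D B)"
    and "sC = f (dist E C) (dist C D) (dist D E)"
    and "tC = f (dist C D) (dist D E) (dist E C)"
    and "S = sA * sB * sC"
    and "T = tA * tB * tC"
  shows "concurrent (proj_line (proj A) G) (proj_line (proj B) H) (proj_line (proj C) I)
         \<longleftrightarrow> S + T = 0"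
proof -
  have ind: "lin_indep3 (A, 1::real) (B, 1) (C, 1)"
    using assms(2) by (simp add: collinear_iff_lifts_dependent)
  have notin: "A \<notin> l" "B \<notin> l" "C \<notin> l" and dim: "aff_dim l = 1"
    using assms(3) by (auto simp: admissible_transversal_def)
  have onl: "D \<in> l" "E \<in> l" "F \<in> l" using assms(4-6) by auto
  have "D \<in> affine hull {B, C}" "E \<in> affine hull {C, A}" "F \<in> affine hull {A, B}"
    using assms(4-6) by auto
  then obtain d e r where D: "D = (1 - d) *\<^sub>R B + d *\<^sub>R C"
    and E: "E = (1 - e) *\<^sub>R C + e *\<^sub>R A" and F: "F = (1 - r) *\<^sub>R A + r *\<^sub>R B"
    by (meson affine_hull_2_obtain)
  have nz: "d \<noteq> 0" "e \<noteq> 0" "r \<noteq> 0" "d \<noteq> 1" "e \<noteq> 1" "r \<noteq> 1"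
    using D E F onl notin by auto
  have "collinear {D, E, F}" by (rule aff_dim_1_collinear[OF dim]) (use onl in auto)
  from menelaus[OF ind this D E F nz]
  have men: "(1 - d) * (1 - e) * (1 - r) = - (d * e * r)" .
  obtain u1 where G: "G = bary_point A E F u1 sA tA" and nzA: "sA \<noteq> 0 \<or> tA \<noteq> 0"
    using X_point_nondegenerate[OF assms(7,10)] unfolding assms(13,14) by metis
  obtain u2 where H: "H = bary_point B F D u2 sB tB" and nzB: "sB \<noteq> 0 \<or> tB \<noteq> 0"
    using X_point_nondegenerate[OF assms(8,11)] unfolding assms(15,16) by metis
  obtain u3 where I: "I = bary_point C D E u3 sC tC" and nzC: "sC \<noteq> 0 \<or> tC \<noteq> 0"
    using X_point_nondegenerate[OF assms(9,12)] unfolding assms(17,18) by metis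
  have "concurrent (proj_line (proj A) G) (proj_line (proj B) H) (proj_line (proj C) I)
    \<longleftrightarrow> (sB * (1 - r)) * (sC * (1 - d)) * (sA * (1 - e)) = (tC * e) * (tA * r) * (tB * d)"
    unfolding G H I corner_line_eq_cevian[OF E F] corner_line_eq_cevian[OF F D]
      corner_line_eq_cevian[OF D E]
    by (rule ceva[OF ind]) (use nz nzA nzB nzC in auto)
  also have "\<dots> \<longleftrightarrow> S * ((1 - d) * (1 - e) * (1 - r)) = T * (d * e * r)"
    unfolding assms(19,20) by (simp add: mult_ac)
  also have "\<dots> \<longleftrightarrow> (S + T) * (d * e * r) = 0"
    unfolding men by (auto simp: algebra_simps)
  also have "\<dots> \<longleftrightarrow> S + T = 0" using nz by simp
  finally show ?thesis .
qed

end
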